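(* Let $\alpha>0$, $J_n=n^{-(1+\alpha)}$ for $n\ge1$, $J=\zeta(1+\alpha)$, and let $\omega_A,\omega_B>0$ with $\omega_A=2\omega_B$. For $\epsilon>0$ define $$q_0=\sqrt{\omega_A+2\epsilon J},\qquad q_n=\frac{\epsilon\left(J_nq_0+\sum_{m=1}^{n-1}(J_{n-m}+J_{n+m})q_m\right)}{\epsilon(2J-J_{2n})+\omega_A}\quad(n\ge1),\qquad q_{-n}=q_n,$$ $$g_1=g_0=\sqrt{\omega_B+\epsilon(2J-J_1)},\qquad g_n=\frac{\epsilon\sum_{m=1}^{n-1}(J_{n-m}+J_{n+m-1})g_m}{\epsilon(2J-J_{2n-1})+\omega_B}\quad(n\ge2),\qquad g_n=g_{-(n-1)},$$ and $E_A=E[q]$, $E_B=E[g]$, where $E[u]=\frac\epsilon4\sum_{n\ne m}\frac{|u_n-u_m|^2}{|n-m|^{1+\alpha}}-\frac14\sum_{n\in\mathbb{Z}}|u_n|^4$. Then as $\epsilon\to0$, $$E_A\sim-\frac{\omega_A^2}4+\left(-2\zeta(2+2\alpha)+\zeta(1+\alpha)^2\right)\epsilon^2,$$ $$E_B\sim-\frac{\omega_B^2}2+\left(-2\sum_{n=2}^\infty\left(\frac1{n^{1+\alpha}}+\frac1{(n-1)^{1+\alpha}}\right)^2+\frac12(2\zeta(1+\alpha)-1)^2\right)\epsilon^2.$$ Therefore $E_A(\omega_A)\sim2E_B(\omega_B)$ and $$\Delta E_{AB}:=E_A-E_B\sim-\frac{\omega_A^2}8+\left(2\sum_{n=2}^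\infty\left(\frac1{n^{1+\alpha}}+\frac1{(n-1)^{1+\alpha}}\right)^2-(\zeta(1+\alpha)-1)^2-2\zeta(2+2\alpha)+\frac12\right)\epsilon^2.$$
   Context: In $E[u]$ the double sum is over ordered pairs $(n,m)\in\mathbb{Z}^2$, $n\ne m$. $\zeta$ is the Riemann zeta function. The notation $a\sim b$ denotes asymptotic equivalence, $a/b\to1$. The quantity $\Delta E_{AB}$ is called the Peierls–Nabarro barrier; the relation $\omega_A=2\omega_B$ is assumed so that the two modes have (to leading order) equal power. *)

theory Defs
  imports "HOL-Analysis.Analysis" "HOL-Library.Landau_Symbols"
begin

text \<open>Only used for \<open>s > 1\<close>, where the Dirichlet series converges.\<close>
definition zeta :: "real \<Rightarrow> real" where
  "zeta s = (\<Sum>n. 1 / real (Suc n) powr s)"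

definition coupling :: "real \<Rightarrow> nat \<Rightarrow> real" where
  "coupling \<alpha> n = real n powr (- (1 + \<alpha>))"

text \<open>Terms of the on-site sequence \<open>q\<close> with index \<open>n \<ge> 0\<close>.\<close>
fun onsite_nat :: "real \<Rightarrow> real \<Rightarrow> real \<Rightarrow> nat \<Rightarrow> real" where
  "onsite_nat \<alpha> \<omega> \<epsilon> n =
     (if n = 0 then sqrt (\<omega> + 2 * \<epsilon> * zeta (1 + \<alpha>))
      else \<epsilon> * (coupling \<alpha> n * onsite_nat \<alpha> \<omega> \<epsilon> 0
                + (\<Sum>m\<in>{1..<n}. (coupling \<alpha> (n - m) + coupling \<alpha> (n + m)) * onsite_nat \<alpha> \<omega> \<epsilon> m))
           / (\<epsilon> * (2 * zeta (1 + \<alpha>) - coupling \<alpha> (2 * n)) + \<omega>))"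

declare onsite_nat.simps [simp del]

definition onsite :: "real \<Rightarrow> real \<Rightarrow> real \<Rightarrow> int \<Rightarrow> real" where
  "onsite \<alpha> \<omega> \<epsilon> n = onsite_nat \<alpha> \<omega> \<epsilon> (nat \<bar>n\<bar>)"

text \<open>Terms of the off-site sequence \<open>g\<close> with index \<open>n \<ge> 0\<close>; the first branch covers \<open>n = 0\<close> and \<open>n = 1\<close>.\<close>
fun offsite_nat :: "real \<Rightarrow> real \<Rightarrow> real \<Rightarrow> nat \<Rightarrow> real" where
  "offsite_nat \<alpha> \<omega> \<epsilon> n =
     (if n \<le> 1 then sqrt (\<omega> + \<epsilon> * (2 * zeta (1 + \<alpha>) - coupling \<alpha> 1))
      else \<epsilon> * (\<Sum>m\<in>{1..<n}. (coupling \<alpha> (n - m) + coupling \<alpha> (n + m - 1)) * offsite_nat \<alpha> \<omega> \<epsilon> m)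
           / (\<epsilon> * (2 * zeta (1 + \<alpha>) - coupling \<alpha> (2 * n - 1)) + \<omega>))"

declare offsite_nat.simps [simp del]

text \<open>The extension by the reflection \<open>n \<mapsto> - (n - 1)\<close>, which exchanges the sites \<open>0\<close> and \<open>1\<close>.\<close>
definition offsite :: "real \<Rightarrow> real \<Rightarrow> real \<Rightarrow> int \<Rightarrow> real" where
  "offsite \<alpha> \<omega> \<epsilon> n = offsite_nat \<alpha> \<omega> \<epsilon> (if n \<ge> 0 then nat n else nat (- (n - 1)))"

definition energy :: "real \<Rightarrow> real \<Rightarrow> (int \<Rightarrow> real) \<Rightarrow> real" where
  "energy \<alpha> \<epsilon> u =
     \<epsilon> / 4 * (\<Sum>\<^sub>\<infinity>(n, m)\<in>{(n, m). n \<noteq> m}. \<bar>u n - u m\<bar>\<^sup>2 / of_int \<bar>n - m\<bar> powr (1 + \<alpha>))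
     - 1 / 4 * (\<Sum>\<^sub>\<infinity>n\<in>UNIV. \<bar>u n\<bar> ^ 4)"

end

theory Submission
  imports Defs
begin

text \<open>Since the coupling is summable, the recursion is a contraction in \<open>\<ell>\<^sup>1\<close> for small \<open>\<epsilon>\<close>: the tail
  of either mode equals \<open>\<epsilon> / \<omega>\<close> times the field of its core plus an \<open>\<ell>\<^sup>1\<close> error \<open>O(\<epsilon>\<^sup>2)\<close>, and has norm
  \<open>O(\<epsilon>)\<close>. In the energy the tail therefore contributes at order \<open>\<epsilon>\<^sup>2\<close> only through its pairing with
  the core, all other tail terms being \<open>O(\<epsilon>\<^sup>3)\<close>; the remaining core terms form a polynomial in \<open>\<epsilon>\<close>
  whose linear coefficient vanishes.\<close>

section \<open>Unconditional sums of powers and of reflected families\<close>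

text \<open>Each term of a nonnegative family is at most the total \<open>s\<close>, hence
  \<open>f x ^ Suc k \<le> s ^ k * f x\<close>. This bounds the square and quartic sums of the tail
  by powers of its sum.\<close>

lemma has_sum_power_nonneg:
  fixes f :: "'a \<Rightarrow> real"
  assumes f: "(f has_sum s) A" and nonneg: "\<And>x. x \<in> A \<Longrightarrow> 0 \<le> f x"
  obtains t where "((\<lambda>x. f x ^ Suc k) has_sum t) A" "0 \<le> t" "t \<le> s ^ Suc k"
proof -
  have le: "f x \<le> s" if "x \<in> A" for x
    using finite_sum_le_has_sum[OF f, of "{x}"] that nonneg by auto
  have dom: "f x ^ Suc k \<le> s ^ k * f x" if "x \<in> A" for x
    using mult_right_mono[OF power_mono[OF le[OF that] nonneg[OF that], of k] nonneg[OF that]]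
    by (simp add: mult.commute)
  have bound: "((\<lambda>x. s ^ k * f x) has_sum (s ^ k * s)) A"
    by (intro has_sum_cmult_right f)
  have "(\<lambda>x. f x ^ Suc k) summable_on A"
    by (rule summable_on_comparison_test[OF has_sum_imp_summable[OF bound]])
      (use dom nonneg in \<open>auto intro: zero_le_power\<close>)
  then obtain t where t: "((\<lambda>x. f x ^ Suc k) has_sum t) A"
    by (auto simp: summable_on_def)
  show ?thesis
  proof (rule that[OF t])
    show "0 \<le> t"
      by (rule has_sum_nonneg[OF t]) (use nonneg in \<open>auto intro: zero_le_power\<close>)
    show "t \<le> s ^ Suc k"
      using has_sum_mono[OF t bound dom] by (simp add: mult.commute)
  qed
qed

text \<open>The reflection \<open>i \<mapsto> r - i\<close> maps the integers above \<open>r\<close>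
  onto the negative ones, so both halves of the complement carry the same sum.\<close>

lemma has_sum_int_reflected:
  fixes f :: "int \<Rightarrow> real" and r :: nat
  assumes symm: "\<And>i. f (int r - i) = f i"
    and tail: "((\<lambda>n. f (int n)) has_sum s) {r<..}"
  shows "(f has_sum (2 * s)) (- {0..int r})"
proof -
  have right: "(f has_sum s) (int ` {r<..})"
    by (subst has_sum_reindex) (use tail in \<open>auto simp: o_def\<close>)
  have left: "(f has_sum s) ((\<lambda>n. int r - int n) ` {r<..})"
    by (subst has_sum_reindex) (use tail symm in \<open>auto simp: o_def inj_on_def\<close>)
  have "(f has_sum (s + s)) (int ` {r<..} \<union> (\<lambda>n. int r - int n) ` {r<..})"
    by (rule has_sum_Un_disjoint[OF right left]) auto
  moreover have "int ` {r<..} \<union> (\<lambda>n. int r - int n) ` {r<..} = - {0..int r}" (is "?L = ?R")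
  proof
    show "?L \<subseteq> ?R" by auto
    show "?R \<subseteq> ?L"
    proof
      fix i assume "i \<in> ?R"
      then consider "i > int r" | "i < 0" by fastforce
      then show "i \<in> ?L"
      proof cases
        case 1
        then have "i = int (nat i)" "nat i \<in> {r<..}" by auto
        then show ?thesis by blast
      next
        case 2
        then have "i = int r - int (nat (int r - i))" "nat (int r - i) \<in> {r<..}" by auto
        then show ?thesis by blast
      qed
    qed
  qed
  ultimately show ?thesis by simp
qed

section \<open>The coupling and its sums\<close>

lemma coupling_nonneg: "0 \<le> coupling \<alpha> n"
  by (simp add: coupling_def)

lemma coupling_0 [simp]: "coupling \<alpha> 0 = 0"
  by (simp add: coupling_def)

lemma coupling_1 [simp]: "coupling \<alpha> (Suc 0) = 1"
  by (simp add: coupling_def)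

lemma coupling_le_1:
  assumes "\<alpha> > 0"
  shows "coupling \<alpha> n \<le> 1"
proof (cases "n = 0")
  case False
  then have "real n powr (- (1 + \<alpha>)) \<le> real n powr 0"
    using assms by (intro powr_mono) auto
  with False show ?thesis by (simp add: coupling_def)
qed simp

lemma coupling_eq: "coupling \<alpha> n = 1 / real n powr (1 + \<alpha>)"
  by (simp only: coupling_def powr_minus_divide)

lemma zeta_has_sum:
  assumes "s > 1"
  shows "((\<lambda>n. 1 / real n powr s) has_sum zeta s) UNIV"
proof -
  have "summable (\<lambda>n. real n powr (- s))"
    using assms by (simp add: summable_real_powr_iff)
  then have "summable (\<lambda>n. real (Suc n) powr (- s))"
    by (rule summable_Suc_iff[THEN iffD2])
  then have "(\<lambda>n. 1 / real (Suc n) powr s) sums zeta s"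
    unfolding zeta_def by (intro summable_sums) (simp add: powr_minus_divide)
  \<comment> \<open>The added term at index 0 is \<open>1 / 0\<close>, which is 0, so sums may run
    over all naturals.\<close>
  then have "(\<lambda>n. 1 / real n powr s) sums (zeta s + 1 / real 0 powr s)"
    by (rule sums_Suc)
  then show ?thesis
    by (intro sums_nonneg_imp_has_sum) auto
qed

lemma coupling_has_sum:
  assumes "\<alpha> > 0"
  shows "(coupling \<alpha> has_sum zeta (1 + \<alpha>)) UNIV"
  using zeta_has_sum[of "1 + \<alpha>"] assms by (simp add: coupling_eq[abs_def])

lemma coupling_square: "(coupling \<alpha> n)\<^sup>2 = 1 / real n powr (2 + 2 * \<alpha>)"
proof -
  have "(coupling \<alpha> n)\<^sup>2 = real n powr (- (1 + \<alpha>) + - (1 + \<alpha>))"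
    unfolding coupling_def power2_eq_square by (rule powr_add[symmetric])
  also have "- (1 + \<alpha>) + - (1 + \<alpha>) = - (2 + 2 * \<alpha>)" by simp
  finally show ?thesis by (simp only: powr_minus_divide)
qed

lemma coupling_square_has_sum:
  assumes "\<alpha> > 0"
  shows "((\<lambda>n. (coupling \<alpha> n)\<^sup>2) has_sum zeta (2 + 2 * \<alpha>)) UNIV"
  using zeta_has_sum[of "2 + 2 * \<alpha>"] assms by (simp add: coupling_square[abs_def])

lemma zeta_ge_1:
  assumes "\<alpha> > 0"
  shows "1 \<le> zeta (1 + \<alpha>)"
  using finite_sum_le_has_sum[OF coupling_has_sum[OF assms], of "{1}"]
  by (simp add: coupling_nonneg)

lemma coupling_has_sum_int:
  assumes "\<alpha> > 0"
  shows "((\<lambda>k. coupling \<alpha> (nat \<bar>k\<bar>)) has_sum (2 * zeta (1 + \<alpha>))) (UNIV :: int set)"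
proof -
  \<comment> \<open>Index 0 can be left out because \<open>coupling \<alpha> 0 = 0\<close>; the
    reflection lemma then applies with \<open>r = 0\<close>.\<close>
  have "(coupling \<alpha> has_sum zeta (1 + \<alpha>)) {0<..}"
    using coupling_has_sum[OF assms]
    by (subst has_sum_cong_neutral[where T = UNIV and g = "coupling \<alpha>"]) auto
  then have "((\<lambda>k. coupling \<alpha> (nat \<bar>k\<bar>)) has_sum (2 * zeta (1 + \<alpha>))) (- {0..int 0})"
    by (intro has_sum_int_reflected) auto
  then show ?thesis
    by (subst has_sum_cong_neutral[where T = "- {0..int 0}" and g = "\<lambda>k. coupling \<alpha> (nat \<bar>k\<bar>)"])
      auto
qed

lemma coupling_has_sum_shift:
  assumes "\<alpha> > 0"
  shows "((\<lambda>m. coupling \<alpha> (nat \<bar>n - m\<bar>)) has_sum (2 * zeta (1 + \<alpha>))) (UNIV :: int set)"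
  by (subst has_sum_reindex_bij_betw[of "\<lambda>m. n - m" UNIV UNIV "\<lambda>k. coupling \<alpha> (nat \<bar>k\<bar>)"])
    (auto intro!: coupling_has_sum_int assms bij_betwI[where g = "\<lambda>m. n - m"])

section \<open>Decomposition of the energy\<close>

text \<open>Expanding the square \<open>(u n - u m)\<^sup>2\<close> splits the kinetic energy into a diagonal part and
  the interaction of distinct sites; since \<open>coupling \<alpha> 0 = 0\<close>, all sums may run over all pairs.\<close>
lemma energy_eq:
  fixes u :: "int \<Rightarrow> real"
  assumes \<alpha>: "\<alpha> > 0"
    and u2: "((\<lambda>n. (u n)\<^sup>2) has_sum s) UNIV"
    and u4: "((\<lambda>n. u n ^ 4) has_sum t) UNIV"
    and inter: "((\<lambda>(n, m). coupling \<alpha> (nat \<bar>n - m\<bar>) * u n * u m) has_sum x) (UNIV \<times> UNIV)"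
  shows "energy \<alpha> \<epsilon> u = \<epsilon> * zeta (1 + \<alpha>) * s - \<epsilon> / 2 * x - t / 4"
proof -
  let ?J = "\<lambda>n m. coupling \<alpha> (nat \<bar>n - m\<bar>)"
  \<comment> \<open>All terms of the diagonal part are nonnegative, so summability of the iterated
    sum gives summability over pairs.\<close>
  have inner: "((\<lambda>m. (u n)\<^sup>2 * ?J n m) has_sum ((u n)\<^sup>2 * (2 * zeta (1 + \<alpha>)))) UNIV" for n
    by (intro has_sum_cmult_right coupling_has_sum_shift \<alpha>)
  have outer: "((\<lambda>n. (u n)\<^sup>2 * (2 * zeta (1 + \<alpha>))) has_sum (s * (2 * zeta (1 + \<alpha>)))) UNIV"
    by (intro has_sum_cmult_left u2)
  have diag: "((\<lambda>(n, m). (u n)\<^sup>2 * ?J n m) has_sum (s * (2 * zeta (1 + \<alpha>)))) (UNIV \<times> UNIV)"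
    using inner outer
    by (intro has_sum_SigmaI[where g = "\<lambda>n. (u n)\<^sup>2 * (2 * zeta (1 + \<alpha>))"]
          summable_on_SigmaI[where g = "\<lambda>n. (u n)\<^sup>2 * (2 * zeta (1 + \<alpha>))"])
      (auto intro: has_sum_imp_summable simp: coupling_nonneg)
  have diag': "((\<lambda>(n, m). (u m)\<^sup>2 * ?J n m) has_sum (s * (2 * zeta (1 + \<alpha>)))) (UNIV \<times> UNIV)"
    using diag by (subst has_sum_swap) (simp add: abs_minus_commute)
  have "((\<lambda>p. (case p of (n, m) \<Rightarrow> (u n)\<^sup>2 * ?J n m) + (case p of (n, m) \<Rightarrow> (u m)\<^sup>2 * ?J n m)
          + (-2) * (case p of (n, m) \<Rightarrow> ?J n m * u n * u m))
        has_sum (s * (2 * zeta (1 + \<alpha>)) + s * (2 * zeta (1 + \<alpha>)) + (-2) * x)) (UNIV \<times> UNIV)"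
    by (intro has_sum_add diag diag' has_sum_cmult_right inter)
  \<comment> \<open>Pairs with \<open>n = m\<close> contribute 0 to the expanded sum, so the
    summation can be restricted to \<open>n \<noteq> m\<close>.\<close>
  then have "((\<lambda>(n, m). \<bar>u n - u m\<bar>\<^sup>2 / of_int \<bar>n - m\<bar> powr (1 + \<alpha>))
        has_sum (4 * zeta (1 + \<alpha>) * s - 2 * x)) {(n, m). n \<noteq> m}"
    by (subst has_sum_cong_neutral[where T = "UNIV \<times> UNIV"])
      (auto simp: coupling_eq field_simps power2_eq_square)
  then have kinetic: "(\<Sum>\<^sub>\<infinity>(n, m)\<in>{(n, m). n \<noteq> m}. \<bar>u n - u m\<bar>\<^sup>2 / of_int \<bar>n - m\<bar> powr (1 + \<alpha>))
      = 4 * zeta (1 + \<alpha>) * s - 2 * x"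
    by (rule infsumI)
  have "(\<Sum>\<^sub>\<infinity>n. \<bar>u n\<bar> ^ 4) = t"
    using u4 by (intro infsumI) simp
  then show ?thesis
    unfolding energy_def kinetic by (simp add: algebra_simps)
qed

text \<open>The plane of pairs splits into four blocks along core and tail. The core block is a
  finite sum, the two mixed blocks agree by symmetry and give \<open>Q * y\<close> each, and the
  tail block is at most \<open>b\<^sup>2\<close> because the coupling is at most 1. For a tail sum
  \<open>b\<close> of order \<open>\<epsilon>\<close> the last block is therefore of second
  order.\<close>

lemma interaction_split:
  fixes u :: "int \<Rightarrow> real"
  assumes \<alpha>: "\<alpha> > 0" and K: "finite K" and core: "\<And>k. k \<in> K \<Longrightarrow> u k = Q"
    and nonneg: "\<And>i. 0 \<le> u i" and tail: "(u has_sum b) (- K)"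
    and pair: "((\<lambda>i. (\<Sum>k\<in>K. coupling \<alpha> (nat \<bar>i - k\<bar>)) * u i) has_sum y) (- K)"
  obtains x where
    "((\<lambda>(n, m). coupling \<alpha> (nat \<bar>n - m\<bar>) * u n * u m) has_sum
        (Q\<^sup>2 * (\<Sum>n\<in>K. \<Sum>m\<in>K. coupling \<alpha> (nat \<bar>n - m\<bar>)) + 2 * Q * y + x)) (UNIV \<times> UNIV)"
    "0 \<le> x" "x \<le> b\<^sup>2"
proof -
  let ?J = "\<lambda>n m. coupling \<alpha> (nat \<bar>n - m\<bar>)"
  let ?F = "\<lambda>(n, m). ?J n m * u n * u m"
  let ?c = "\<lambda>i. \<Sum>k\<in>K. ?J i k"
  have KK: "(?F has_sum (Q\<^sup>2 * (\<Sum>n\<in>K. \<Sum>m\<in>K. ?J n m))) (K \<times> K)"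
    by (rule has_sum_finiteI)
      (use K core in \<open>auto simp: sum.cartesian_product[symmetric] sum_distrib_left
        power2_eq_square mult_ac intro!: sum.cong\<close>)
  have inner: "((\<lambda>m. ?F (n, m)) has_sum (Q * (?c n * u n))) K" if "n \<in> - K" for n
    by (rule has_sum_finiteI)
      (use K core in \<open>auto simp: sum_distrib_left sum_distrib_right mult_ac intro!: sum.cong\<close>)
  have outer: "((\<lambda>n. Q * (?c n * u n)) has_sum (Q * y)) (- K)"
    by (intro has_sum_cmult_right pair)
  have TK: "(?F has_sum (Q * y)) ((- K) \<times> K)"
    using inner outer nonneg
    by (intro has_sum_SigmaI[where g = "\<lambda>n. Q * (?c n * u n)"]
          summable_on_SigmaI[where g = "\<lambda>n. Q * (?c n * u n)"])
      (auto intro: has_sum_imp_summable simp: coupling_nonneg)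
  have KT: "(?F has_sum (Q * y)) (K \<times> (- K))"
    using TK by (subst has_sum_swap) (simp add: abs_minus_commute mult_ac)
  have prod: "((\<lambda>(n, m). u n * u m) has_sum (b * b)) ((- K) \<times> (- K))"
    using nonneg tail
    by (intro has_sum_SigmaI[where g = "\<lambda>n. u n * b"] summable_on_SigmaI[where g = "\<lambda>n. u n * b"])
      (auto intro: has_sum_imp_summable has_sum_cmult_right has_sum_cmult_left)
  have dom: "?F p \<le> (case p of (n, m) \<Rightarrow> u n * u m)" for p
    using mult_right_mono[OF coupling_le_1[OF \<alpha>, of "nat \<bar>fst p - snd p\<bar>"],
        of "u (fst p) * u (snd p)"] nonneg
    by (simp add: split_beta mult.assoc)
  have F_nonneg: "0 \<le> ?F p" for p
    using nonneg by (auto simp: coupling_nonneg split_beta)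
  have "?F summable_on ((- K) \<times> (- K))"
    by (rule summable_on_comparison_test[OF has_sum_imp_summable[OF prod]])
      (use dom F_nonneg in auto)
  then obtain x where x: "(?F has_sum x) ((- K) \<times> (- K))"
    by (auto simp: summable_on_def)
  have split: "UNIV \<times> UNIV = (K \<times> K \<union> (- K) \<times> K) \<union> (K \<times> (- K) \<union> (- K) \<times> (- K))" by auto
  have all: "(?F has_sum ((Q\<^sup>2 * (\<Sum>n\<in>K. \<Sum>m\<in>K. ?J n m) + Q * y) + (Q * y + x))) (UNIV \<times> UNIV)"
    unfolding split by (intro has_sum_Un_disjoint KK TK KT x) auto
  show ?thesis
  proof (rule that)
    show "(?F has_sum (Q\<^sup>2 * (\<Sum>n\<in>K. \<Sum>m\<in>K. ?J n m) + 2 * Q * y + x)) (UNIV \<times> UNIV)"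
      using all by (simp add: algebra_simps)
    show "0 \<le> x" by (rule has_sum_nonneg[OF x]) (use F_nonneg in auto)
    show "x \<le> b\<^sup>2"
      unfolding power2_eq_square by (rule has_sum_mono[OF x prod]) (use dom in auto)
  qed
qed

text \<open>The tail estimates close only on initial intervals, where the recursion stays inside the
  summation range, while unconditional sums require all finite sets. Nonnegativity bridges the
  two.\<close>

lemma sum_le_greaterThanAtMost:
  fixes f :: "nat \<Rightarrow> real" and r :: nat
  assumes "\<And>n. 0 \<le> f n" "finite F" "F \<subseteq> {r<..}" "\<And>N. sum f {r<..N} \<le> b"
  shows "sum f F \<le> b"
proof -
  \<comment> \<open>Inserting 0 keeps the maximum meaningful for empty \<open>F\<close>.\<close>
  have "F \<subseteq> {r<..Max (insert 0 F)}" using assms(2,3) by auto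
  then have "sum f F \<le> sum f {r<..Max (insert 0 F)}"
    using assms by (intro sum_mono2) auto
  then show ?thesis using assms(4) order_trans by blast
qed

section \<open>Modes with a constant core\<close>

text \<open>For \<open>r \<le> 1\<close> and \<open>n > r\<close> this is the field produced at site
  \<open>n\<close> by unit amplitudes on the core: site 0 alone if \<open>r = 0\<close>, sites 0 and
  1 if \<open>r = 1\<close>.\<close>

definition core_coupling :: "real \<Rightarrow> nat \<Rightarrow> nat \<Rightarrow> real" where
  "core_coupling \<alpha> r n = coupling \<alpha> n + real r * coupling \<alpha> (n - 1)"

text \<open>The on-site mode is the case \<open>r = 0\<close> and the off-site mode the case \<open>r = 1\<close>: the amplitude is
  constant on the core \<open>{0..r}\<close> and symmetric under \<open>i \<mapsto> r - i\<close>.\<close>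
locale peaked_mode =
  fixes \<alpha> \<omega> \<epsilon> :: real and r :: nat and a :: "nat \<Rightarrow> real"
  fixes z Q :: real and w :: "nat \<Rightarrow> real"
  defines "z \<equiv> zeta (1 + \<alpha>)"
    and "Q \<equiv> sqrt (\<omega> + \<epsilon> * (2 * z - real r))"
    and "w \<equiv> \<lambda>n. \<Sum>m\<in>{r<..<n}. (coupling \<alpha> (n - m) + coupling \<alpha> (n + m - r)) * a m"
  assumes \<alpha>: "\<alpha> > 0" and \<omega>: "\<omega> > 0" and \<epsilon>: "\<epsilon> > 0" and r: "r \<le> 1"
    and small: "4 * z * \<epsilon> \<le> \<omega>"
    and core: "\<And>n. n \<le> r \<Longrightarrow> a n = Q"
    and tail: "\<And>n. r < n \<Longrightarrow> a n = \<epsilon> * (Q * core_coupling \<alpha> r n + w n)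
                              / (\<epsilon> * (2 * z - coupling \<alpha> (2 * n - r)) + \<omega>)"
begin

abbreviation c :: "nat \<Rightarrow> real" where "c \<equiv> core_coupling \<alpha> r"

text \<open>Both extensions in the statement have this form: for negative \<open>i\<close> the
  on-site index is \<open>0 - i\<close> and the off-site index is \<open>1 - i\<close>.\<close>

definition u :: "int \<Rightarrow> real" where
  "u i = a (if 0 \<le> i then nat i else nat (int r - i))"

section \<open>Pointwise bounds on the amplitude\<close>

lemma z_ge_1: "1 \<le> z"
  unfolding z_def using \<alpha> by (rule zeta_ge_1)

lemma Q_square: "Q\<^sup>2 = \<omega> + \<epsilon> * (2 * z - real r)"
  unfolding Q_def using z_ge_1 \<omega> \<epsilon> r by (intro real_sqrt_pow2) (auto intro!: add_nonneg_nonneg)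

lemma Q_nonneg: "0 \<le> Q"
  unfolding Q_def using z_ge_1 \<omega> \<epsilon> r by (auto intro!: add_nonneg_nonneg)

text \<open>Smallness of \<open>\<epsilon>\<close> keeps \<open>Q\<^sup>2\<close> comparable to
  \<open>\<omega>\<close>, which eliminates \<open>Q\<close> from the final error bounds.\<close>

lemma Q_square_le: "Q\<^sup>2 \<le> 2 * \<omega>"
proof -
  have "\<epsilon> * (2 * z - real r) \<le> \<epsilon> * (4 * z)"
    using z_ge_1 \<epsilon> by (intro mult_left_mono) auto
  with small show ?thesis unfolding Q_square by (simp add: mult_ac)
qed

lemma c_nonneg: "0 \<le> c n"
  by (simp add: core_coupling_def coupling_nonneg)

lemma c_le_2: "c n \<le> 2"
proof -
  have "real r * coupling \<alpha> (n - 1) \<le> 1 * 1"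
    using r coupling_le_1[OF \<alpha>] by (intro mult_mono) (auto simp: coupling_nonneg)
  with coupling_le_1[OF \<alpha>, of n] show ?thesis by (simp add: core_coupling_def)
qed

text \<open>Distinct arguments pick distinct terms of the full coupling sum, so one bound serves all
  shifted rows.\<close>

lemma sum_coupling_le:
  assumes "finite F" "inj_on h F"
  shows "(\<Sum>n\<in>F. coupling \<alpha> (h n)) \<le> z"
proof -
  have "(\<Sum>n\<in>F. coupling \<alpha> (h n)) = sum (coupling \<alpha>) (h ` F)"
    using assms by (simp add: sum.reindex)
  also have "\<dots> \<le> z"
    unfolding z_def using assms
    by (intro finite_sum_le_has_sum[OF coupling_has_sum[OF \<alpha>]]) (auto simp: coupling_nonneg)
  finally show ?thesis .
qed

lemma sum_c_le: "sum c {r<..N} \<le> 2 * z"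
proof -
  have "real r * (\<Sum>n\<in>{r<..N}. coupling \<alpha> (n - 1)) \<le> 1 * z"
    using r z_ge_1
    by (intro mult_mono sum_coupling_le) (auto simp: inj_on_def intro!: sum_nonneg coupling_nonneg)
  moreover have "sum (coupling \<alpha>) {r<..N} \<le> z"
    using sum_coupling_le[of "{r<..N}" "\<lambda>n. n"] by (simp add: inj_on_def)
  ultimately show ?thesis
    by (simp add: core_coupling_def[abs_def] sum.distrib sum_distrib_left)
qed

lemma denom_bounds:
  "\<omega> \<le> \<epsilon> * (2 * z - coupling \<alpha> n) + \<omega>" "\<epsilon> * (2 * z - coupling \<alpha> n) + \<omega> \<le> \<omega> + 2 * z * \<epsilon>"
  using z_ge_1 \<epsilon> coupling_le_1[OF \<alpha>, of n] coupling_nonneg[of \<alpha> n] by (auto simp: algebra_simps)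

text \<open>Strong induction applies since \<open>w n\<close> involves only \<open>a m\<close> with
  \<open>m < n\<close>.\<close>

lemma a_nonneg: "0 \<le> a n"
proof (induction n rule: less_induct)
  case (less n)
  show ?case
  proof (cases "n \<le> r")
    case True
    then show ?thesis by (simp add: core Q_nonneg)
  next
    case False
    have "0 \<le> w n"
      unfolding w_def using less by (auto intro!: sum_nonneg mult_nonneg_nonneg simp: coupling_nonneg)
    moreover have "0 \<le> \<epsilon> * (2 * z - coupling \<alpha> (2 * n - r)) + \<omega>"
      using denom_bounds(1)[of "2 * n - r"] \<omega> by linarith
    ultimately show ?thesis
      using False \<epsilon> Q_nonneg c_nonneg by (simp add: tail)
  qed
qed

lemma w_nonneg: "0 \<le> w n"
  unfolding w_def by (auto intro!: sum_nonneg mult_nonneg_nonneg simp: coupling_nonneg a_nonneg)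

lemma a_le:
  assumes "r < n"
  shows "a n \<le> \<epsilon> / \<omega> * (Q * c n + w n)"
proof -
  have "\<epsilon> * (Q * c n + w n) / (\<epsilon> * (2 * z - coupling \<alpha> (2 * n - r)) + \<omega>) \<le> \<epsilon> * (Q * c n + w n) / \<omega>"
    using denom_bounds(1)[of "2 * n - r"] \<omega> \<epsilon> Q_nonneg c_nonneg w_nonneg
    by (intro divide_left_mono) (auto intro!: mult_nonneg_nonneg add_nonneg_nonneg)
  then show ?thesis using assms by (simp add: tail)
qed

text \<open>After the nonnegative \<open>w n\<close> is dropped, only the denominator
  \<open>D \<le> \<omega> + 2 * z * \<epsilon>\<close> matters. From \<open>(\<omega> - 2 * z *
  \<epsilon>) * (\<omega> + 2 * z * \<epsilon>) \<le> \<omega>\<^sup>2\<close> follows \<open>1 / D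
  \<ge> (\<omega> - 2 * z * \<epsilon>) / \<omega>\<^sup>2\<close>.\<close>

lemma a_ge:
  assumes "r < n"
  shows "\<epsilon> / \<omega> * (Q * c n) - 2 * z * \<epsilon>\<^sup>2 / \<omega>\<^sup>2 * (Q * c n) \<le> a n"
proof -
  let ?D = "\<epsilon> * (2 * z - coupling \<alpha> (2 * n - r)) + \<omega>"
  have D: "\<omega> \<le> ?D" "?D \<le> \<omega> + 2 * z * \<epsilon>" by (fact denom_bounds)+
  have "(\<omega> - 2 * z * \<epsilon>) * ?D \<le> (\<omega> - 2 * z * \<epsilon>) * (\<omega> + 2 * z * \<epsilon>)"
    using D small \<omega> by (intro mult_left_mono) auto
  also have "\<dots> = \<omega>\<^sup>2 - (2 * z * \<epsilon>)\<^sup>2"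
    by (simp add: power2_eq_square algebra_simps)
  also have "\<dots> \<le> \<omega>\<^sup>2" by simp
  finally have "(\<omega> - 2 * z * \<epsilon>) / \<omega>\<^sup>2 \<le> 1 / ?D"
    using D \<omega> by (simp add: divide_simps)
  then have "(\<omega> - 2 * z * \<epsilon>) / \<omega>\<^sup>2 * (\<epsilon> * (Q * c n)) \<le> 1 / ?D * (\<epsilon> * (Q * c n))"
    using \<epsilon> Q_nonneg c_nonneg by (intro mult_right_mono) auto
  moreover have "(\<omega> - 2 * z * \<epsilon>) / \<omega>\<^sup>2 * (\<epsilon> * (Q * c n))
      = \<epsilon> / \<omega> * (Q * c n) - 2 * z * \<epsilon>\<^sup>2 / \<omega>\<^sup>2 * (Q * c n)"
    using \<omega> by (simp add: field_simps power2_eq_square)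
  moreover have "1 / ?D * (\<epsilon> * (Q * c n)) \<le> \<epsilon> * (Q * c n + w n) / ?D"
  proof -
    have "\<epsilon> * (Q * c n) \<le> \<epsilon> * (Q * c n + w n)"
      using \<epsilon> w_nonneg[of n] by (intro mult_left_mono) auto
    then show ?thesis using divide_right_mono[of _ _ ?D] D \<omega> by simp
  qed
  ultimately show ?thesis using tail[OF assms] by simp
qed

section \<open>Summed bounds on the tail and its deviation from first order\<close>

text \<open>This is the \<open>\<ell>\<^sup>1\<close> bound for convolution: after exchanging the
  sums, each amplitude \<open>a m\<close> is weighted by two rows of couplings, each of total at
  most \<open>z\<close>.\<close>

lemma sum_w_le: "sum w {r<..N} \<le> 2 * z * sum a {r<..N}"
proof -
  have "sum w {r<..N} = (\<Sum>n\<in>{r<..N}. \<Sum>m\<in>{m\<in>{r<..N}. m < n}.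
      (coupling \<alpha> (n - m) + coupling \<alpha> (n + m - r)) * a m)"
    unfolding w_def by (intro sum.cong) auto
  also have "\<dots> = (\<Sum>m\<in>{r<..N}. \<Sum>n\<in>{n\<in>{r<..N}. m < n}.
      (coupling \<alpha> (n - m) + coupling \<alpha> (n + m - r)) * a m)"
    by (rule sum.swap_restrict) auto
  also have "\<dots> \<le> (\<Sum>m\<in>{r<..N}. 2 * z * a m)"
  proof (rule sum_mono)
    fix m assume m: "m \<in> {r<..N}"
    let ?G = "{n\<in>{r<..N}. m < n}"
    have "(\<Sum>n\<in>?G. coupling \<alpha> (n - m)) \<le> z"
      by (rule sum_coupling_le) (auto simp: inj_on_def)
    \<comment> \<open>As \<open>m > r\<close>, the natural subtraction does not truncate, so the
      shifted index is injective.\<close>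
    moreover have "(\<Sum>n\<in>?G. coupling \<alpha> (n + m - r)) \<le> z"
      by (rule sum_coupling_le) (use m in \<open>auto simp: inj_on_def\<close>)
    ultimately have "(\<Sum>n\<in>?G. coupling \<alpha> (n - m) + coupling \<alpha> (n + m - r)) * a m \<le> 2 * z * a m"
      by (intro mult_right_mono a_nonneg) (simp add: sum.distrib)
    then show "(\<Sum>n\<in>?G. (coupling \<alpha> (n - m) + coupling \<alpha> (n + m - r)) * a m) \<le> 2 * z * a m"
      by (simp add: sum_distrib_right)
  qed
  finally show ?thesis by (simp add: sum_distrib_left)
qed

text \<open>The recursion bounds the \<open>\<ell>\<^sup>1\<close> norm of the tail by \<open>O(\<epsilon>)\<close> plus itself times
  \<open>2 * z * \<epsilon> / \<omega> \<le> 1 / 2\<close>.\<close>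
lemma sum_a_le: "sum a {r<..N} \<le> 4 * z * \<epsilon> * Q / \<omega>"
proof -
  let ?A = "sum a {r<..N}"
  have "?A \<le> (\<Sum>n\<in>{r<..N}. \<epsilon> / \<omega> * (Q * c n + w n))"
    by (intro sum_mono a_le) auto
  also have "\<dots> = \<epsilon> / \<omega> * (Q * sum c {r<..N} + sum w {r<..N})"
    by (simp only: sum_distrib_left sum.distrib[symmetric])
  also have "\<dots> \<le> \<epsilon> / \<omega> * (Q * (2 * z) + 2 * z * ?A)"
    using sum_c_le[of N] sum_w_le[of N] \<epsilon> \<omega> Q_nonneg by (intro mult_left_mono add_mono) auto
  finally have "\<omega> * ?A \<le> 2 * z * \<epsilon> * Q + 2 * z * \<epsilon> * ?A"
    using \<omega> by (simp add: field_simps)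
  moreover have "4 * z * \<epsilon> * ?A \<le> \<omega> * ?A"
    using small by (intro mult_right_mono sum_nonneg a_nonneg) auto
  ultimately have "\<omega> * ?A \<le> 4 * z * \<epsilon> * Q" by linarith
  then show ?thesis using \<omega> by (simp add: field_simps)
qed

text \<open>From above the deviation is at most the tail field
  \<open>\<epsilon> / \<omega> * w n\<close>, from below the loss in the denominator. Summed, they
  contribute 8 and 4 to the constant 12.\<close>

lemma sum_deviation_le:
  "(\<Sum>n\<in>{r<..N}. \<bar>a n - \<epsilon> / \<omega> * (Q * c n)\<bar>) \<le> 12 * z\<^sup>2 * \<epsilon>\<^sup>2 * Q / \<omega>\<^sup>2"
proof -
  have dev: "\<bar>a n - \<epsilon> / \<omega> * (Q * c n)\<bar> \<le> \<epsilon> / \<omega> * w n + 2 * z * \<epsilon>\<^sup>2 / \<omega>\<^sup>2 * Q * c n" if "r < n" for n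
  proof -
    have "0 \<le> \<epsilon> / \<omega> * w n" "0 \<le> 2 * z * \<epsilon>\<^sup>2 / \<omega>\<^sup>2 * (Q * c n)"
      using \<epsilon> \<omega> w_nonneg Q_nonneg c_nonneg z_ge_1 by auto
    with a_le[OF that] a_ge[OF that] show ?thesis
      by (simp add: abs_le_iff distrib_left mult.assoc)
  qed
  have "(\<Sum>n\<in>{r<..N}. \<bar>a n - \<epsilon> / \<omega> * (Q * c n)\<bar>)
      \<le> \<epsilon> / \<omega> * sum w {r<..N} + 2 * z * \<epsilon>\<^sup>2 / \<omega>\<^sup>2 * Q * sum c {r<..N}"
    unfolding sum_distrib_left sum.distrib[symmetric] by (intro sum_mono dev) auto
  also have "\<dots> \<le> \<epsilon> / \<omega> * (2 * z * (4 * z * \<epsilon> * Q / \<omega>)) + 2 * z * \<epsilon>\<^sup>2 / \<omega>\<^sup>2 * Q * (2 * z)"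
  proof (intro add_mono mult_left_mono sum_c_le)
    show "sum w {r<..N} \<le> 2 * z * (4 * z * \<epsilon> * Q / \<omega>)"
      using sum_w_le[of N] mult_left_mono[OF sum_a_le[of N], of "2 * z"] z_ge_1 by linarith
  qed (use \<epsilon> \<omega> z_ge_1 Q_nonneg in auto)
  also have "\<dots> = 12 * z\<^sup>2 * \<epsilon>\<^sup>2 * Q / \<omega>\<^sup>2"
    using \<omega> by (simp add: field_simps power2_eq_square)
  finally show ?thesis .
qed

section \<open>Passage to infinite sums over the tail\<close>

lemma c_square_has_sum: "((\<lambda>n. (c n)\<^sup>2) has_sum (\<Sum>\<^sub>\<infinity>n\<in>{r<..}. (c n)\<^sup>2)) {r<..}"
proof -
  have "(\<Sum>n\<in>F. (c n)\<^sup>2) \<le> 4 * z" if "finite F" "F \<subseteq> {r<..}" for F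
  proof -
    have "(\<Sum>n\<in>F. (c n)\<^sup>2) \<le> 2 * sum c F"
      unfolding sum_distrib_left power2_eq_square using c_le_2 c_nonneg
      by (intro sum_mono mult_right_mono) auto
    also have "sum c F \<le> 2 * z"
      using c_nonneg that sum_c_le by (rule sum_le_greaterThanAtMost)
    finally show ?thesis by simp
  qed
  then have "(\<lambda>n. (c n)\<^sup>2) summable_on {r<..}"
    by (intro nonneg_bdd_above_summable_on bdd_aboveI2) auto
  then show ?thesis by (rule has_sum_infsum)
qed

lemma a_has_sum:
  obtains A where "(a has_sum A) {r<..}" "0 \<le> A" "A \<le> 4 * z * \<epsilon> * Q / \<omega>"
proof -
  have fin: "sum a F \<le> 4 * z * \<epsilon> * Q / \<omega>" if "finite F" "F \<subseteq> {r<..}" for F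
    using a_nonneg that sum_a_le by (rule sum_le_greaterThanAtMost)
  have "a summable_on {r<..}"
    using fin by (intro nonneg_bdd_above_summable_on a_nonneg bdd_aboveI2) auto
  then obtain A where A: "(a has_sum A) {r<..}"
    by (auto simp: summable_on_def)
  show ?thesis
  proof (rule that[OF A])
    show "0 \<le> A" using A by (rule has_sum_nonneg) (rule a_nonneg)
    show "A \<le> 4 * z * \<epsilon> * Q / \<omega>" using A fin by (rule has_sum_le_finite_sums)
  qed
qed

text \<open>The pairing of tail and core field is the only second-order contribution of the tail.
  Replacing \<open>a\<close> by its first-order value costs at most twice the summed deviation,
  since \<open>c \<le> 2\<close>.\<close>

lemma ca_has_sum:
  assumes C: "((\<lambda>n. (c n)\<^sup>2) has_sum C) {r<..}"
  obtains Y where "((\<lambda>n. c n * a n) has_sum Y) {r<..}"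
    "\<bar>Y - \<epsilon> * Q / \<omega> * C\<bar> \<le> 24 * z\<^sup>2 * \<epsilon>\<^sup>2 * Q / \<omega>\<^sup>2"
proof -
  obtain A where A: "(a has_sum A) {r<..}" by (rule a_has_sum)
  have "(\<lambda>n. c n * a n) summable_on {r<..}"
    by (rule summable_on_comparison_test[OF has_sum_imp_summable[OF has_sum_cmult_right[OF A]], of _ 2])
      (auto intro!: mult_right_mono c_le_2 a_nonneg mult_nonneg_nonneg c_nonneg)
  then obtain Y where Y: "((\<lambda>n. c n * a n) has_sum Y) {r<..}"
    by (auto simp: summable_on_def)
  let ?d = "\<lambda>n. a n - \<epsilon> / \<omega> * (Q * c n)"
  let ?b = "24 * z\<^sup>2 * \<epsilon>\<^sup>2 * Q / \<omega>\<^sup>2"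
  have "((\<lambda>n. c n * a n + (- (\<epsilon> * Q / \<omega>)) * (c n)\<^sup>2) has_sum (Y + (- (\<epsilon> * Q / \<omega>)) * C)) {r<..}"
    by (intro has_sum_add Y has_sum_cmult_right C)
  then have diff: "((\<lambda>n. c n * ?d n) has_sum (Y - \<epsilon> * Q / \<omega> * C)) {r<..}"
    by (simp add: algebra_simps power2_eq_square)
  have fin: "(\<Sum>n\<in>F. \<bar>c n * ?d n\<bar>) \<le> ?b" if "finite F" "F \<subseteq> {r<..}" for F
  proof -
    have "(\<Sum>n\<in>F. \<bar>c n * ?d n\<bar>) \<le> 2 * (\<Sum>n\<in>F. \<bar>?d n\<bar>)"
      unfolding sum_distrib_left abs_mult using c_le_2 c_nonneg
      by (intro sum_mono mult_right_mono) auto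
    also have "(\<Sum>n\<in>F. \<bar>?d n\<bar>) \<le> 12 * z\<^sup>2 * \<epsilon>\<^sup>2 * Q / \<omega>\<^sup>2"
      by (rule sum_le_greaterThanAtMost[OF _ that sum_deviation_le]) simp
    finally show ?thesis by simp
  qed
  have "Y - \<epsilon> * Q / \<omega> * C \<le> ?b"
  proof (rule has_sum_le_finite_sums[OF diff])
    fix F assume "finite F" "F \<subseteq> {r<..}"
    from fin[OF this] show "(\<Sum>n\<in>F. c n * ?d n) \<le> ?b"
      using sum_abs[of "\<lambda>n. c n * ?d n" F] by linarith
  qed
  \<comment> \<open>Finite partial sums bound a limit from above only, so the lower bound comes from
    the negated family.\<close>
  moreover have "- (Y - \<epsilon> * Q / \<omega> * C) \<le> ?b"
  proof (rule has_sum_le_finite_sums)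
    show "((\<lambda>n. - (c n * ?d n)) has_sum - (Y - \<epsilon> * Q / \<omega> * C)) {r<..}"
      using diff by (simp only: has_sum_uminus minus_minus)
    fix F assume "finite F" "F \<subseteq> {r<..}"
    from fin[OF this] show "(\<Sum>n\<in>F. - (c n * ?d n)) \<le> ?b"
      using sum_abs[of "\<lambda>n. c n * ?d n" F] by (simp only: sum_negf)
  qed
  ultimately show ?thesis using Y by (intro that) (auto simp: abs_le_iff)
qed

section \<open>The mode on all integers\<close>

lemma u_symm: "u (int r - i) = u i"
proof -
  consider "i < 0" | "0 \<le> i" "i \<le> int r" | "int r < i" by linarith
  then show ?thesis
  proof cases
    case 2
    then have "nat i \<le> r" "nat (int r - i) \<le> r" by auto
    with 2 show ?thesis by (simp add: u_def core)
  qed (auto simp: u_def)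
qed

lemma u_core: "i \<in> {0..int r} \<Longrightarrow> u i = Q"
  by (auto simp: u_def core)

lemma u_nonneg: "0 \<le> u i"
  by (simp add: u_def a_nonneg)

lemma u_int [simp]: "u (int n) = a n"
  by (simp add: u_def)

text \<open>The core has \<open>r + 1\<close> sites of amplitude \<open>Q\<close>, and the reflected
  tail counts twice.\<close>

lemma u_power_has_sum:
  assumes "((\<lambda>n. a n ^ k) has_sum s) {r<..}"
  shows "((\<lambda>i. u i ^ k) has_sum ((real r + 1) * Q ^ k + 2 * s)) UNIV"
proof -
  have "((\<lambda>i. u i ^ k) has_sum ((real r + 1) * Q ^ k)) {0..int r}"
    by (rule has_sum_finiteI) (auto simp: u_core)
  moreover have "((\<lambda>i. u i ^ k) has_sum (2 * s)) (- {0..int r})"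
    using assms by (intro has_sum_int_reflected) (auto simp: u_symm)
  ultimately have "((\<lambda>i. u i ^ k) has_sum ((real r + 1) * Q ^ k + 2 * s)) ({0..int r} \<union> - {0..int r})"
    by (rule has_sum_Un_disjoint) auto
  then show ?thesis by (simp add: Compl_partition)
qed

text \<open>Diagonal pairs vanish; for \<open>r = 1\<close> the ordered pairs \<open>(0, 1)\<close>
  and \<open>(1, 0)\<close> contribute 1 each.\<close>

lemma core_interaction:
  "(\<Sum>n\<in>{0..int r}. \<Sum>m\<in>{0..int r}. coupling \<alpha> (nat \<bar>n - m\<bar>)) = 2 * real r"
proof -
  have "{0..1} = {0, 1 :: int}" by auto
  moreover have "r = 0 \<or> r = 1" using r by auto
  ultimately show ?thesis by auto
qed

text \<open>The field of the core inherits the reflection symmetry and equals \<open>c n\<close> at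
  sites \<open>n > r\<close>, so the two sides of the tail pair equally.\<close>

lemma core_pair_has_sum:
  assumes Y: "((\<lambda>n. c n * a n) has_sum Y) {r<..}"
  shows "((\<lambda>i. (\<Sum>k\<in>{0..int r}. coupling \<alpha> (nat \<bar>i - k\<bar>)) * u i) has_sum (2 * Y)) (- {0..int r})"
proof (rule has_sum_int_reflected)
  fix i
  have "(\<Sum>k\<in>{0..int r}. coupling \<alpha> (nat \<bar>int r - i - k\<bar>)) = (\<Sum>k\<in>{0..int r}. coupling \<alpha> (nat \<bar>i - k\<bar>))"
    by (rule sum.reindex_bij_witness[of _ "\<lambda>k. int r - k" "\<lambda>k. int r - k"])
      (auto simp: abs_minus_commute intro!: arg_cong[where f = "coupling \<alpha>"])
  then show "(\<Sum>k\<in>{0..int r}. coupling \<alpha> (nat \<bar>int r - i - k\<bar>)) * u (int r - i)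
      = (\<Sum>k\<in>{0..int r}. coupling \<alpha> (nat \<bar>i - k\<bar>)) * u i"
    by (simp add: u_symm)
next
  have "(\<Sum>k\<in>{0..int r}. coupling \<alpha> (nat \<bar>int n - k\<bar>)) = c n" if "r < n" for n
  proof -
    have "{0..1} = {0, 1 :: int}" by auto
    moreover have "nat (int n - 1) = n - 1" using that by auto
    moreover have "r = 0 \<or> r = 1" using r by auto
    ultimately show ?thesis using that by (auto simp: core_coupling_def)
  qed
  then show "((\<lambda>n. (\<Sum>k\<in>{0..int r}. coupling \<alpha> (nat \<bar>int n - k\<bar>)) * u (int n)) has_sum Y) {r<..}"
    using Y by (subst has_sum_cong[where g = "\<lambda>n. c n * a n"]) auto
qed

section \<open>Energy up to third order\<close>

text \<open>The difference from \<open>P\<close> is computed exactly and consists of five terms: the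
  diagonal, self-interaction and quartic energies of the tail, the error of its pairing with the
  core, and the replacement of \<open>Q\<^sup>2\<close> by \<open>\<omega>\<close> in that pairing.
  Each is bounded by a multiple of \<open>\<epsilon> ^ 3\<close>.\<close>

lemma energy_error:
  fixes C P
  defines "C \<equiv> \<Sum>\<^sub>\<infinity>n\<in>{r<..}. (c n)\<^sup>2"
    and "P \<equiv> - (real r + 1) * \<omega>\<^sup>2 / 4 + (- 2 * C + (real r + 1) / 4 * (2 * z - real r)\<^sup>2) * \<epsilon>\<^sup>2"
  shows "\<bar>energy \<alpha> \<epsilon> u - P\<bar> \<le> (192 * z ^ 3 + 160 * z\<^sup>2 + 4 * z * C) / \<omega> * \<epsilon> ^ 3"
proof -
  have C: "((\<lambda>n. (c n)\<^sup>2) has_sum C) {r<..}"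
    unfolding C_def by (rule c_square_has_sum)
  obtain A where A: "(a has_sum A) {r<..}" "0 \<le> A" "A \<le> 4 * z * \<epsilon> * Q / \<omega>"
    by (rule a_has_sum)
  obtain s where s: "((\<lambda>n. a n ^ Suc 1) has_sum s) {r<..}" "0 \<le> s" "s \<le> A ^ Suc 1"
    using a_nonneg by (rule has_sum_power_nonneg[OF A(1)])
  obtain t where t: "((\<lambda>n. a n ^ Suc 3) has_sum t) {r<..}" "0 \<le> t" "t \<le> A ^ Suc 3"
    using a_nonneg by (rule has_sum_power_nonneg[OF A(1)])
  obtain Y where Y: "((\<lambda>n. c n * a n) has_sum Y) {r<..}"
    "\<bar>Y - \<epsilon> * Q / \<omega> * C\<bar> \<le> 24 * z\<^sup>2 * \<epsilon>\<^sup>2 * Q / \<omega>\<^sup>2"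
    using C by (rule ca_has_sum)
  have tail_sum: "(u has_sum (2 * A)) (- {0..int r})"
    using A(1) by (intro has_sum_int_reflected) (auto simp: u_symm)
  obtain x where x: "((\<lambda>(n, m). coupling \<alpha> (nat \<bar>n - m\<bar>) * u n * u m) has_sum
        (Q\<^sup>2 * (\<Sum>n\<in>{0..int r}. \<Sum>m\<in>{0..int r}. coupling \<alpha> (nat \<bar>n - m\<bar>)) + 2 * Q * (2 * Y) + x))
        (UNIV \<times> UNIV)"
    "0 \<le> x" "x \<le> (2 * A)\<^sup>2"
    using interaction_split[OF \<alpha> _ u_core u_nonneg tail_sum core_pair_has_sum[OF Y(1)]] by auto
  have E: "energy \<alpha> \<epsilon> u = \<epsilon> * z * ((real r + 1) * Q\<^sup>2 + 2 * s)
      - \<epsilon> / 2 * (Q\<^sup>2 * (2 * real r) + 2 * Q * (2 * Y) + x) - ((real r + 1) * Q ^ 4 + 2 * t) / 4"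
    unfolding z_def using x(1) u_power_has_sum[of 2 s] u_power_has_sum[of 4 t] s(1) t(1)
    by (intro energy_eq \<alpha>) (simp_all add: core_interaction numeral_eq_Suc)
  have diff: "energy \<alpha> \<epsilon> u - P = 2 * z * \<epsilon> * s - \<epsilon> / 2 * x - t / 2
      - 2 * \<epsilon> * Q * (Y - \<epsilon> * Q / \<omega> * C) - 2 * \<epsilon>\<^sup>2 * C * (Q\<^sup>2 / \<omega> - 1)"
  proof -
    \<comment> \<open>Put \<open>\<delta> = \<epsilon> * (2 * z - k)\<close>, so
      \<open>q = \<omega> + \<delta>\<close>. As \<open>k * (k + 1) = 2 * k\<close> for
      \<open>k\<close> in \<open>{0, 1}\<close>, the core terms collapse to
      \<open>(k + 1) * (\<delta>\<^sup>2 - \<omega>\<^sup>2) / 4\<close>, which has no linear term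
      in \<open>\<epsilon>\<close>.\<close>
    have poly: "\<epsilon> * z * ((k + 1) * q + 2 * s) - \<epsilon> / 2 * (q * (2 * k) + 2 * y + x)
        - ((k + 1) * q\<^sup>2 + 2 * t) / 4
        - (- (k + 1) * \<omega>\<^sup>2 / 4 + (- 2 * C + (k + 1) / 4 * (2 * z - k)\<^sup>2) * \<epsilon>\<^sup>2)
        = 2 * z * \<epsilon> * s - \<epsilon> / 2 * x - t / 2 - \<epsilon> * y + 2 * \<epsilon>\<^sup>2 * C"
      if "q = \<omega> + \<epsilon> * (2 * z - k)" "k = 0 \<or> k = 1" for k q y :: real
      using that(2) by (elim disjE) (simp_all add: that(1) field_simps power2_eq_square)
    have "real r = 0 \<or> real r = 1" using r by auto
    from poly[OF Q_square this, of "2 * Q * Y"]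
    have "energy \<alpha> \<epsilon> u - P
        = 2 * z * \<epsilon> * s - \<epsilon> / 2 * x - t / 2 - \<epsilon> * (2 * Q * Y) + 2 * \<epsilon>\<^sup>2 * C"
      unfolding E P_def by (simp add: mult.assoc)
    moreover have "2 * \<epsilon> * Q * (Y - \<epsilon> * Q / \<omega> * C) = \<epsilon> * (2 * Q * Y) - 2 * \<epsilon>\<^sup>2 * C * (Q\<^sup>2 / \<omega>)"
      by (simp add: right_diff_distrib power2_eq_square)
    ultimately show ?thesis by (simp add: right_diff_distrib)
  qed
  have A2: "A\<^sup>2 \<le> 32 * z\<^sup>2 * \<epsilon>\<^sup>2 / \<omega>"
  proof -
    have "A\<^sup>2 \<le> (4 * z * \<epsilon> * Q / \<omega>)\<^sup>2" using A by (intro power_mono)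
    also have "\<dots> = 16 * z\<^sup>2 * \<epsilon>\<^sup>2 / \<omega>\<^sup>2 * Q\<^sup>2" by (simp add: power_mult_distrib power_divide)
    also have "\<dots> \<le> 16 * z\<^sup>2 * \<epsilon>\<^sup>2 / \<omega>\<^sup>2 * (2 * \<omega>)"
      by (intro mult_left_mono Q_square_le) auto
    also have "\<dots> = 32 * z\<^sup>2 * \<epsilon>\<^sup>2 / \<omega>" using \<omega> by (simp add: field_simps power2_eq_square)
    finally show ?thesis .
  qed
  have e1: "0 \<le> 2 * z * \<epsilon> * s" "2 * z * \<epsilon> * s \<le> 64 * z ^ 3 / \<omega> * \<epsilon> ^ 3"
  proof -
    show "0 \<le> 2 * z * \<epsilon> * s" using z_ge_1 \<epsilon> s by simp
    have "2 * z * \<epsilon> * s \<le> 2 * z * \<epsilon> * (32 * z\<^sup>2 * \<epsilon>\<^sup>2 / \<omega>)"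
      using z_ge_1 \<epsilon> s A2 by (intro mult_left_mono) (auto simp: power2_eq_square)
    then show "2 * z * \<epsilon> * s \<le> 64 * z ^ 3 / \<omega> * \<epsilon> ^ 3"
      by (simp add: power2_eq_square power3_eq_cube mult_ac)
  qed
  have e2: "0 \<le> \<epsilon> / 2 * x" "\<epsilon> / 2 * x \<le> 64 * z\<^sup>2 / \<omega> * \<epsilon> ^ 3"
  proof -
    show "0 \<le> \<epsilon> / 2 * x" using \<epsilon> x by simp
    \<comment> \<open>The factor 4 arises because the two-sided tail has sum
      \<open>2 * A\<close>.\<close>
    have "\<epsilon> / 2 * x \<le> \<epsilon> / 2 * (4 * (32 * z\<^sup>2 * \<epsilon>\<^sup>2 / \<omega>))"
      using \<epsilon> x A2 by (intro mult_left_mono) (auto simp: power_mult_distrib)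
    then show "\<epsilon> / 2 * x \<le> 64 * z\<^sup>2 / \<omega> * \<epsilon> ^ 3"
      by (simp add: power2_eq_square power3_eq_cube mult_ac)
  qed
  have e3: "0 \<le> t / 2" "t / 2 \<le> 128 * z ^ 3 / \<omega> * \<epsilon> ^ 3"
  proof -
    show "0 \<le> t / 2" using t by simp
    have "t \<le> (A\<^sup>2)\<^sup>2" using t by (simp add: numeral_eq_Suc mult_ac)
    also have "\<dots> \<le> (32 * z\<^sup>2 * \<epsilon>\<^sup>2 / \<omega>)\<^sup>2" by (intro power_mono A2) auto
    \<comment> \<open>The quartic term is of order \<open>\<epsilon> ^ 4\<close>; one factor
      \<open>4 * z * \<epsilon>\<close> is split off to be bounded by
      \<open>\<omega>\<close>.\<close>
    also have "\<dots> = 256 * z ^ 3 * \<epsilon> ^ 3 / \<omega>\<^sup>2 * (4 * z * \<epsilon>)"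
      by (simp add: numeral_eq_Suc)
    also have "\<dots> \<le> 256 * z ^ 3 * \<epsilon> ^ 3 / \<omega>\<^sup>2 * \<omega>"
      using z_ge_1 \<epsilon> by (intro mult_left_mono small) auto
    also have "\<dots> = 256 * z ^ 3 / \<omega> * \<epsilon> ^ 3" using \<omega> by (simp add: field_simps power2_eq_square)
    finally show "t / 2 \<le> 128 * z ^ 3 / \<omega> * \<epsilon> ^ 3" by simp
  qed
  have e4: "\<bar>2 * \<epsilon> * Q * (Y - \<epsilon> * Q / \<omega> * C)\<bar> \<le> 96 * z\<^sup>2 / \<omega> * \<epsilon> ^ 3"
  proof -
    have "\<bar>2 * \<epsilon> * Q * (Y - \<epsilon> * Q / \<omega> * C)\<bar> = 2 * \<epsilon> * Q * \<bar>Y - \<epsilon> * Q / \<omega> * C\<bar>"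
      using \<epsilon> Q_nonneg by (simp add: abs_mult)
    also have "\<dots> \<le> 2 * \<epsilon> * Q * (24 * z\<^sup>2 * \<epsilon>\<^sup>2 * Q / \<omega>\<^sup>2)"
      using \<epsilon> Q_nonneg by (intro mult_left_mono Y) auto
    also have "\<dots> = 48 * z\<^sup>2 * \<epsilon> ^ 3 / \<omega>\<^sup>2 * Q\<^sup>2"
      by (simp add: power2_eq_square power3_eq_cube mult_ac)
    also have "\<dots> \<le> 48 * z\<^sup>2 * \<epsilon> ^ 3 / \<omega>\<^sup>2 * (2 * \<omega>)"
      using \<epsilon> by (intro mult_left_mono Q_square_le) auto
    also have "\<dots> = 96 * z\<^sup>2 / \<omega> * \<epsilon> ^ 3" using \<omega> by (simp add: field_simps power2_eq_square)
    finally show ?thesis .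
  qed
  have e5: "0 \<le> 2 * \<epsilon>\<^sup>2 * C * (Q\<^sup>2 / \<omega> - 1)" "2 * \<epsilon>\<^sup>2 * C * (Q\<^sup>2 / \<omega> - 1) \<le> 4 * z * C / \<omega> * \<epsilon> ^ 3"
  proof -
    have C0: "0 \<le> C" using C by (rule has_sum_nonneg) auto
    have q: "Q\<^sup>2 / \<omega> - 1 = \<epsilon> * (2 * z - real r) / \<omega>"
      using \<omega> by (simp add: Q_square field_simps)
    show "0 \<le> 2 * \<epsilon>\<^sup>2 * C * (Q\<^sup>2 / \<omega> - 1)"
      unfolding q using C0 \<epsilon> \<omega> z_ge_1 r by (intro mult_nonneg_nonneg divide_nonneg_nonneg) auto
    have "2 * \<epsilon>\<^sup>2 * C * (Q\<^sup>2 / \<omega> - 1) \<le> 2 * \<epsilon>\<^sup>2 * C * (\<epsilon> * (2 * z) / \<omega>)"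
      unfolding q using C0 \<epsilon> \<omega> by (intro mult_left_mono divide_right_mono) auto
    then show "2 * \<epsilon>\<^sup>2 * C * (Q\<^sup>2 / \<omega> - 1) \<le> 4 * z * C / \<omega> * \<epsilon> ^ 3"
      by (simp add: power2_eq_square power3_eq_cube mult_ac)
  qed
  have total: "(192 * z ^ 3 + 160 * z\<^sup>2 + 4 * z * C) / \<omega> * \<epsilon> ^ 3
      = 64 * z ^ 3 / \<omega> * \<epsilon> ^ 3 + 64 * z\<^sup>2 / \<omega> * \<epsilon> ^ 3 + 128 * z ^ 3 / \<omega> * \<epsilon> ^ 3
        + 96 * z\<^sup>2 / \<omega> * \<epsilon> ^ 3 + 4 * z * C / \<omega> * \<epsilon> ^ 3"
    by (simp add: add_divide_distrib algebra_simps)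
  have "\<bar>p1 - p2 - p3 - p4 - p5\<bar> \<le> b1 + b2 + b3 + b4 + b5"
    if "0 \<le> p1" "p1 \<le> b1" "0 \<le> p2" "p2 \<le> b2" "0 \<le> p3" "p3 \<le> b3" "\<bar>p4\<bar> \<le> b4" "0 \<le> p5" "p5 \<le> b5"
    for p1 p2 p3 p4 p5 b1 b2 b3 b4 b5 :: real
    using that by linarith
  from this[OF e1 e2 e3 e4 e5] show ?thesis
    unfolding diff total .
qed

end

section \<open>Asymptotics as the coupling strength tends to 0\<close>

text \<open>The error constant does not depend on \<open>\<epsilon>\<close>, so the remainder is
  \<open>O(\<epsilon> ^ 3)\<close> and hence \<open>o(\<epsilon>\<^sup>2)\<close>.\<close>

lemma energy_expansion:
  fixes a :: "real \<Rightarrow> nat \<Rightarrow> real" and v :: "real \<Rightarrow> int \<Rightarrow> real"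
  assumes mode: "\<forall>\<^sub>F \<epsilon> in at_right 0. peaked_mode \<alpha> \<omega> \<epsilon> r (a \<epsilon>) \<and> v \<epsilon> = peaked_mode.u r (a \<epsilon>)"
  defines "C \<equiv> \<Sum>\<^sub>\<infinity>n\<in>{r<..}. (core_coupling \<alpha> r n)\<^sup>2"
  shows "(\<lambda>\<epsilon>. energy \<alpha> \<epsilon> (v \<epsilon>) - (- (real r + 1) * \<omega>\<^sup>2 / 4
      + (- 2 * C + (real r + 1) / 4 * (2 * zeta (1 + \<alpha>) - real r)\<^sup>2) * \<epsilon>\<^sup>2)) \<in> o[at_right 0](\<lambda>\<epsilon>. \<epsilon>\<^sup>2)"
    (is "?d \<in> _")
proof -
  let ?K = "(192 * zeta (1 + \<alpha>) ^ 3 + 160 * (zeta (1 + \<alpha>))\<^sup>2 + 4 * zeta (1 + \<alpha>) * C) / \<omega>"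
  have "\<forall>\<^sub>F \<epsilon> in at_right 0. norm (?d \<epsilon>) \<le> ?K * norm (\<epsilon> ^ 3)"
    using mode eventually_at_right_less[of 0]
  proof eventually_elim
    case (elim \<epsilon>)
    with peaked_mode.energy_error[of \<alpha> \<omega> \<epsilon> r "a \<epsilon>"] show ?case
      unfolding C_def by simp
  qed
  then have "?d \<in> O[at_right 0](\<lambda>\<epsilon>. \<epsilon> ^ 3)" by (rule bigoI)
  moreover have "(\<lambda>\<epsilon>::real. \<epsilon> ^ 3) \<in> o[at_right 0](\<lambda>\<epsilon>. \<epsilon>\<^sup>2)"
  proof (rule smalloI_tendsto)
    have "((\<lambda>\<epsilon>::real. \<epsilon>) \<longlongrightarrow> 0) (at_right 0)" by (rule tendsto_ident_at)
    moreover have "\<epsilon> ^ 3 / \<epsilon>\<^sup>2 = \<epsilon>" for \<epsilon> :: real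
      by (simp add: power2_eq_square power3_eq_cube)
    ultimately show "((\<lambda>\<epsilon>::real. \<epsilon> ^ 3 / \<epsilon>\<^sup>2) \<longlongrightarrow> 0) (at_right 0)"
      by simp
    show "\<forall>\<^sub>F \<epsilon>::real in at_right 0. \<epsilon>\<^sup>2 \<noteq> 0"
      using eventually_at_right_less[of "0 :: real"] by eventually_elim simp
  qed
  ultimately show ?thesis by (rule landau_o.big_small_trans)
qed

lemma tendsto_of_quadratic_expansion:
  fixes E :: "real \<Rightarrow> real"
  assumes "(\<lambda>\<epsilon>. E \<epsilon> - (p + q * \<epsilon>\<^sup>2)) \<in> o[at_right 0](\<lambda>\<epsilon>. \<epsilon>\<^sup>2)"
  shows "(E \<longlongrightarrow> p) (at_right 0)"
proof -
  have sq: "((\<lambda>\<epsilon>::real. \<epsilon>\<^sup>2) \<longlongrightarrow> 0) (at_right 0)"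
    by (auto intro!: tendsto_eq_intros)
  have "((\<lambda>\<epsilon>. (E \<epsilon> - (p + q * \<epsilon>\<^sup>2)) / \<epsilon>\<^sup>2 * \<epsilon>\<^sup>2 + (p + q * \<epsilon>\<^sup>2)) \<longlongrightarrow> 0 * 0 + (p + q * 0)) (at_right 0)"
    by (intro tendsto_intros smalloD_tendsto assms sq)
  moreover have "\<forall>\<^sub>F \<epsilon> in at_right 0. (E \<epsilon> - (p + q * \<epsilon>\<^sup>2)) / \<epsilon>\<^sup>2 * \<epsilon>\<^sup>2 + (p + q * \<epsilon>\<^sup>2) = E \<epsilon>"
    using eventually_at_right_less[of "0 :: real"] by eventually_elim simp
  ultimately show ?thesis
    by (rule Lim_transform_eventually[THEN tendsto_eq_rhs]) simp
qed

text \<open>Both sides tend to the same nonzero constant \<open>p\<close>.\<close>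

lemma asymp_equiv_quadratic_expansion:
  fixes E :: "real \<Rightarrow> real"
  assumes "(\<lambda>\<epsilon>. E \<epsilon> - (p + q * \<epsilon>\<^sup>2)) \<in> o[at_right 0](\<lambda>\<epsilon>. \<epsilon>\<^sup>2)" and "p \<noteq> 0"
  shows "E \<sim>[at_right 0] (\<lambda>\<epsilon>. p + q * \<epsilon>\<^sup>2)"
proof -
  have "((\<lambda>\<epsilon>::real. p + q * \<epsilon>\<^sup>2) \<longlongrightarrow> p) (at_right 0)"
    by (auto intro!: tendsto_eq_intros)
  then have "(\<lambda>\<epsilon>. p + q * \<epsilon>\<^sup>2) \<sim>[at_right 0] (\<lambda>_. p)"
    using \<open>p \<noteq> 0\<close> by (rule tendsto_imp_asymp_equiv_const)
  moreover have "E \<sim>[at_right 0] (\<lambda>_. p)"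
    using tendsto_of_quadratic_expansion[OF assms(1)] \<open>p \<noteq> 0\<close> by (rule tendsto_imp_asymp_equiv_const)
  ultimately show ?thesis
    using asymp_equiv_sym asymp_equiv_trans by blast
qed

lemma eventually_small_coupling:
  fixes \<omega> z :: real
  assumes "\<omega> > 0"
  shows "\<forall>\<^sub>F \<epsilon> in at_right 0. 0 < \<epsilon> \<and> 4 * z * \<epsilon> \<le> \<omega>"
proof -
  have "((\<lambda>\<epsilon>::real. 4 * z * \<epsilon>) \<longlongrightarrow> 0) (at_right 0)"
    by (auto intro!: tendsto_eq_intros)
  from order_tendstoD(2)[OF this assms] eventually_at_right_less[of "0 :: real"]
  show ?thesis by eventually_elim auto
qed

section \<open>The two sequences as peaked modes\<close>

lemma onsite_peaked_mode:
  assumes \<alpha>: "\<alpha> > 0" and \<omega>: "\<omega> > 0"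
  shows "\<forall>\<^sub>F \<epsilon> in at_right 0. peaked_mode \<alpha> \<omega> \<epsilon> 0 (onsite_nat \<alpha> \<omega> \<epsilon>)
    \<and> onsite \<alpha> \<omega> \<epsilon> = peaked_mode.u 0 (onsite_nat \<alpha> \<omega> \<epsilon>)"
  using eventually_small_coupling[OF \<omega>, of "zeta (1 + \<alpha>)"]
proof eventually_elim
  case (elim \<epsilon>)
  have zero: "onsite_nat \<alpha> \<omega> \<epsilon> 0 = sqrt (\<omega> + \<epsilon> * (2 * zeta (1 + \<alpha>) - real 0))"
    by (subst onsite_nat.simps) (simp add: mult_ac)
  \<comment> \<open>The term \<open>coupling \<alpha> n * onsite_nat \<alpha> \<omega> \<epsilon>
    0\<close> of the recursion is the core field for \<open>r = 0\<close>.\<close>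
  have pos: "onsite_nat \<alpha> \<omega> \<epsilon> n = \<epsilon> * (sqrt (\<omega> + \<epsilon> * (2 * zeta (1 + \<alpha>) - real 0)) * core_coupling \<alpha> 0 n
      + (\<Sum>m\<in>{0<..<n}. (coupling \<alpha> (n - m) + coupling \<alpha> (n + m - 0)) * onsite_nat \<alpha> \<omega> \<epsilon> m))
      / (\<epsilon> * (2 * zeta (1 + \<alpha>) - coupling \<alpha> (2 * n - 0)) + \<omega>)" if "0 < n" for n
    using that by (subst onsite_nat.simps)
      (simp add: zero core_coupling_def atLeastSucLessThan_greaterThanLessThan mult.commute)
  have "peaked_mode \<alpha> \<omega> \<epsilon> 0 (onsite_nat \<alpha> \<omega> \<epsilon>)"
    by (rule peaked_mode.intro) (fact pos | use \<alpha> \<omega> elim zero in simp)+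
  then show ?case
    by (auto simp: onsite_def peaked_mode.u_def fun_eq_iff)
qed

lemma offsite_peaked_mode:
  assumes \<alpha>: "\<alpha> > 0" and \<omega>: "\<omega> > 0"
  shows "\<forall>\<^sub>F \<epsilon> in at_right 0. peaked_mode \<alpha> \<omega> \<epsilon> 1 (offsite_nat \<alpha> \<omega> \<epsilon>)
    \<and> offsite \<alpha> \<omega> \<epsilon> = peaked_mode.u 1 (offsite_nat \<alpha> \<omega> \<epsilon>)"
  using eventually_small_coupling[OF \<omega>, of "zeta (1 + \<alpha>)"]
proof eventually_elim
  case (elim \<epsilon>)
  have core: "offsite_nat \<alpha> \<omega> \<epsilon> n = sqrt (\<omega> + \<epsilon> * (2 * zeta (1 + \<alpha>) - real 1))" if "n \<le> 1" for n
    using that by (subst offsite_nat.simps) simp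
  have tail: "offsite_nat \<alpha> \<omega> \<epsilon> n = \<epsilon> * (sqrt (\<omega> + \<epsilon> * (2 * zeta (1 + \<alpha>) - real 1)) * core_coupling \<alpha> 1 n
      + (\<Sum>m\<in>{1<..<n}. (coupling \<alpha> (n - m) + coupling \<alpha> (n + m - 1)) * offsite_nat \<alpha> \<omega> \<epsilon> m))
      / (\<epsilon> * (2 * zeta (1 + \<alpha>) - coupling \<alpha> (2 * n - 1)) + \<omega>)" if "1 < n" for n
  proof -
    \<comment> \<open>The summand \<open>m = 1\<close> is a core site: its weight
      \<open>coupling \<alpha> (n - 1) + coupling \<alpha> n\<close> is
      \<open>core_coupling \<alpha> 1 n\<close>, and the rest is the tail field.\<close>
    have "{1..<n} = insert 1 {1<..<n}" using that by auto
    then show ?thesis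
      using that by (subst offsite_nat.simps) (simp add: core core_coupling_def algebra_simps)
  qed
  have "peaked_mode \<alpha> \<omega> \<epsilon> 1 (offsite_nat \<alpha> \<omega> \<epsilon>)"
    by (rule peaked_mode.intro) (fact core tail | use \<alpha> \<omega> elim in simp)+
  then show ?case
    by (auto simp: offsite_def peaked_mode.u_def fun_eq_iff)
qed

section \<open>Energies of the two modes and the Peierls-Nabarro barrier\<close>

text \<open>Each expansion has a nonzero constant term, so asymptotic equivalence alone fixes only
  that term. The little-o claims fix the coefficients of \<open>\<epsilon>\<^sup>2\<close>.\<close>

theorem corollary5p5:
  fixes \<alpha> \<omega>\<^sub>A \<omega>\<^sub>B :: real
  assumes "\<alpha> > 0" and "\<omega>\<^sub>A > 0" and "\<omega>\<^sub>B > 0" and "\<omega>\<^sub>A = 2 * \<omega>\<^sub>B"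
  shows
    "let E\<^sub>A = (\<lambda>\<epsilon>. energy \<alpha> \<epsilon> (onsite \<alpha> \<omega>\<^sub>A \<epsilon>));
         E\<^sub>B = (\<lambda>\<epsilon>. energy \<alpha> \<epsilon> (offsite \<alpha> \<omega>\<^sub>B \<epsilon>));
         \<Delta>E = (\<lambda>\<epsilon>. E\<^sub>A \<epsilon> - E\<^sub>B \<epsilon>);
         S = (\<Sum>\<^sub>\<infinity>n\<in>{2::nat..}. (1 / real n powr (1 + \<alpha>) + 1 / real (n - 1) powr (1 + \<alpha>))\<^sup>2);
         P\<^sub>A = (\<lambda>\<epsilon>. - \<omega>\<^sub>A\<^sup>2 / 4 + (- 2 * zeta (2 + 2 * \<alpha>) + (zeta (1 + \<alpha>))\<^sup>2) * \<epsilon>\<^sup>2);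
         P\<^sub>B = (\<lambda>\<epsilon>. - \<omega>\<^sub>B\<^sup>2 / 2 + (- 2 * S + 1 / 2 * (2 * zeta (1 + \<alpha>) - 1)\<^sup>2) * \<epsilon>\<^sup>2);
         P\<^sub>\<Delta> = (\<lambda>\<epsilon>. - \<omega>\<^sub>A\<^sup>2 / 8
                  + (2 * S - (zeta (1 + \<alpha>) - 1)\<^sup>2 - 2 * zeta (2 + 2 * \<alpha>) + 1 / 2) * \<epsilon>\<^sup>2)
     in E\<^sub>A \<sim>[at_right 0] P\<^sub>A \<and> (\<lambda>\<epsilon>. E\<^sub>A \<epsilon> - P\<^sub>A \<epsilon>) \<in> o[at_right 0](\<lambda>\<epsilon>. \<epsilon>\<^sup>2)
      \<and> E\<^sub>B \<sim>[at_right 0] P\<^sub>B \<and> (\<lambda>\<epsilon>. E\<^sub>B \<epsilon> - P\<^sub>B \<epsilon>) \<in> o[at_right 0](\<lambda>\<epsilon>. \<epsilon>\<^sup>2)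
      \<and> E\<^sub>A \<sim>[at_right 0] (\<lambda>\<epsilon>. 2 * E\<^sub>B \<epsilon>)
      \<and> \<Delta>E \<sim>[at_right 0] P\<^sub>\<Delta> \<and> (\<lambda>\<epsilon>. \<Delta>E \<epsilon> - P\<^sub>\<Delta> \<epsilon>) \<in> o[at_right 0](\<lambda>\<epsilon>. \<epsilon>\<^sup>2)"
proof -
  define E\<^sub>A where "E\<^sub>A = (\<lambda>\<epsilon>. energy \<alpha> \<epsilon> (onsite \<alpha> \<omega>\<^sub>A \<epsilon>))"
  define E\<^sub>B where "E\<^sub>B = (\<lambda>\<epsilon>. energy \<alpha> \<epsilon> (offsite \<alpha> \<omega>\<^sub>B \<epsilon>))"
  define S where "S = (\<Sum>\<^sub>\<infinity>n\<in>{2::nat..}. (1 / real n powr (1 + \<alpha>) + 1 / real (n - 1) powr (1 + \<alpha>))\<^sup>2)"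
  define p where "p = - 2 * zeta (2 + 2 * \<alpha>) + (zeta (1 + \<alpha>))\<^sup>2"
  define q where "q = - 2 * S + 1 / 2 * (2 * zeta (1 + \<alpha>) - 1)\<^sup>2"
  define d where "d = 2 * S - (zeta (1 + \<alpha>) - 1)\<^sup>2 - 2 * zeta (2 + 2 * \<alpha>) + 1 / 2"
  have "((\<lambda>n. (core_coupling \<alpha> 0 n)\<^sup>2) has_sum zeta (2 + 2 * \<alpha>)) {0<..}"
    using coupling_square_has_sum[OF \<open>\<alpha> > 0\<close>]
    by (subst has_sum_cong_neutral[where T = UNIV and g = "\<lambda>n. (coupling \<alpha> n)\<^sup>2"])
      (auto simp: core_coupling_def)
  then have "(\<Sum>\<^sub>\<infinity>n\<in>{0<..}. (core_coupling \<alpha> 0 n)\<^sup>2) = zeta (2 + 2 * \<alpha>)"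
    by (rule infsumI)
  with energy_expansion[OF onsite_peaked_mode[OF assms(1,2)]]
  have A: "(\<lambda>\<epsilon>. E\<^sub>A \<epsilon> - (- \<omega>\<^sub>A\<^sup>2 / 4 + p * \<epsilon>\<^sup>2)) \<in> o[at_right 0](\<lambda>\<epsilon>. \<epsilon>\<^sup>2)"
    by (simp add: E\<^sub>A_def p_def power_mult_distrib)
  have "(\<Sum>\<^sub>\<infinity>n\<in>{1<..}. (core_coupling \<alpha> 1 n)\<^sup>2) = S"
    unfolding S_def by (rule infsum_cong_neutral) (auto simp: core_coupling_def coupling_eq)
  with energy_expansion[OF offsite_peaked_mode[OF assms(1,3)]]
  have B: "(\<lambda>\<epsilon>. E\<^sub>B \<epsilon> - (- \<omega>\<^sub>B\<^sup>2 / 2 + q * \<epsilon>\<^sup>2)) \<in> o[at_right 0](\<lambda>\<epsilon>. \<epsilon>\<^sup>2)"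
    by (simp add: E\<^sub>B_def q_def)
  \<comment> \<open>With \<open>z = zeta (1 + \<alpha>)\<close>, the coefficients match by
    \<open>z\<^sup>2 - (2 * z - 1)\<^sup>2 / 2 = 1 / 2 - (z - 1)\<^sup>2\<close>; the constants
    match by \<open>\<omega>\<^sub>B\<^sup>2 / 2 = \<omega>\<^sub>A\<^sup>2 / 8\<close>.\<close>
  have diff: "(E\<^sub>A \<epsilon> - (- \<omega>\<^sub>A\<^sup>2 / 4 + p * \<epsilon>\<^sup>2)) - (E\<^sub>B \<epsilon> - (- \<omega>\<^sub>B\<^sup>2 / 2 + q * \<epsilon>\<^sup>2))
      = E\<^sub>A \<epsilon> - E\<^sub>B \<epsilon> - (- \<omega>\<^sub>A\<^sup>2 / 8 + d * \<epsilon>\<^sup>2)" for \<epsilon>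
    by (simp add: assms(4) p_def q_def d_def power2_eq_square algebra_simps)
  have D: "(\<lambda>\<epsilon>. E\<^sub>A \<epsilon> - E\<^sub>B \<epsilon> - (- \<omega>\<^sub>A\<^sup>2 / 8 + d * \<epsilon>\<^sup>2)) \<in> o[at_right 0](\<lambda>\<epsilon>. \<epsilon>\<^sup>2)"
    using sum_in_smallo(2)[OF A B] by (simp only: diff)
  have "E\<^sub>A \<sim>[at_right 0] (\<lambda>_. - \<omega>\<^sub>A\<^sup>2 / 4)"
    using tendsto_of_quadratic_expansion[OF A] assms(2) by (intro tendsto_imp_asymp_equiv_const) auto
  moreover have "((\<lambda>\<epsilon>. 2 * E\<^sub>B \<epsilon>) \<longlongrightarrow> 2 * (- \<omega>\<^sub>B\<^sup>2 / 2)) (at_right 0)"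
    by (intro tendsto_intros tendsto_of_quadratic_expansion[OF B])
  then have "(\<lambda>\<epsilon>. 2 * E\<^sub>B \<epsilon>) \<sim>[at_right 0] (\<lambda>_. 2 * (- \<omega>\<^sub>B\<^sup>2 / 2))"
    using assms(3) by (intro tendsto_imp_asymp_equiv_const) auto
  then have "(\<lambda>\<epsilon>. 2 * E\<^sub>B \<epsilon>) \<sim>[at_right 0] (\<lambda>_. - \<omega>\<^sub>A\<^sup>2 / 4)"
    by (simp add: assms(4) power_mult_distrib)
  ultimately have AB: "E\<^sub>A \<sim>[at_right 0] (\<lambda>\<epsilon>. 2 * E\<^sub>B \<epsilon>)"
    using asymp_equiv_sym asymp_equiv_trans by blast
  have "E\<^sub>A \<sim>[at_right 0] (\<lambda>\<epsilon>. - \<omega>\<^sub>A\<^sup>2 / 4 + p * \<epsilon>\<^sup>2)"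
    using A by (rule asymp_equiv_quadratic_expansion) (use assms(2) in simp)
  moreover have "E\<^sub>B \<sim>[at_right 0] (\<lambda>\<epsilon>. - \<omega>\<^sub>B\<^sup>2 / 2 + q * \<epsilon>\<^sup>2)"
    using B by (rule asymp_equiv_quadratic_expansion) (use assms(3) in simp)
  moreover have "(\<lambda>\<epsilon>. E\<^sub>A \<epsilon> - E\<^sub>B \<epsilon>) \<sim>[at_right 0] (\<lambda>\<epsilon>. - \<omega>\<^sub>A\<^sup>2 / 8 + d * \<epsilon>\<^sup>2)"
    using D by (rule asymp_equiv_quadratic_expansion) (use assms(2) in simp)
  ultimately show ?thesis
    using A B D AB unfolding Let_def E\<^sub>A_def E\<^sub>B_def S_def p_def q_def d_def by blast
qed

end
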